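(* Let $V$ be a vector space over a field. The semigroup $L(V)$ is semi-balanced if and only if $V$ is finite-dimensional.
   Context: Maps are written on the right. $L(V)$ is the semigroup of all linear maps $V\to V$ under composition, regarded as a subsemigroup of the semigroup $T(V)$ of all maps $V\to V$. For $f\in T(V)$, the kernel $\ker(f)=\{(x,y)\in V\times V: xf=yf\}$ is an equivalence relation on $V$; a transversal of it is a subset of $V$ containing exactly one element of each class. The collapse $\mathrm{c}(f)$ is the cardinality of the set $V\setminus T_f$, where $T_f$ is any transversal of $\ker(f)$ (the cardinality does not depend on the choice), and the defect $\mathrm{d}(f)$ is the cardinality of the set $V\setminus Vf$. The map $f$ is semi-balanced if $\mathrm{c}(f)=\mathrm{d}(f)$ (as cardinals). A subsemigroup of $T(V)$ is semi-balanced if all its elements are semi-balanced. *)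

theory Defs
  imports Complex_Main
begin

unbundle cardinal_syntax

definition is_transversal :: "('b \<times> 'b) set \<Rightarrow> 'b set \<Rightarrow> bool" where
  "is_transversal r T \<longleftrightarrow> (\<forall>X \<in> UNIV // r. \<exists>!x. x \<in> X \<inter> T)"

lemma ex_transversal_kernel: "\<exists>T. is_transversal (kernel f) T"
proof
  have "\<exists>!x. x \<in> X \<inter> range (\<lambda>x. inv f (f x))" if "X \<in> UNIV // kernel f" for X
  proof -
    have "kernel f `` {a} = {y. f y = f a}" for a
      by (auto simp: kernel_def)
    with that obtain a where X: "X = {y. f y = f a}"
      by (auto simp: quotient_def)
    show ?thesis
    proof (rule ex1I[of _ "inv f (f a)"])
      show "inv f (f a) \<in> X \<inter> range (\<lambda>x. inv f (f x))"
        by (auto simp: X f_inv_into_f)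
      show "x = inv f (f a)" if "x \<in> X \<inter> range (\<lambda>x. inv f (f x))" for x
        using that by (auto simp: X f_inv_into_f)
    qed
  qed
  then show "is_transversal (kernel f) (range (\<lambda>x. inv f (f x)))"
    by (simp add: is_transversal_def)
qed

text \<open>Cardinals are represented, as in the library, by cardinal orders, so two of them are
  compared with \<open>=o\<close> and not with equality. The transversal in the collapse is an arbitrary
  one; \<open>collapse_ordIso\<close> shows that the choice is immaterial.\<close>

definition collapse :: "('b \<Rightarrow> 'b) \<Rightarrow> 'b rel" where
  "collapse f = |UNIV - (SOME T. is_transversal (kernel f) T)|"

definition defect :: "('b \<Rightarrow> 'b) \<Rightarrow> 'b rel" where
  "defect f = |UNIV - range f|"

definition semi_balanced :: "('b \<Rightarrow> 'b) \<Rightarrow> bool" where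
  "semi_balanced f \<longleftrightarrow> collapse f =o defect f"

lemma transversals_same_card:
  assumes "is_transversal (kernel f) T" "is_transversal (kernel f) T'"
  shows "|UNIV - T| =o |UNIV - T'|"
proof -
  have ex: "\<exists>!y. f y = f x \<and> y \<in> S" if "is_transversal (kernel f) S" for x S
  proof -
    have "kernel f `` {x} = {y. f y = f x}"
      by (auto simp: kernel_def)
    then have "{y. f y = f x} \<in> UNIV // kernel f"
      by (metis UNIV_I quotientI)
    with that show ?thesis by (auto simp: is_transversal_def)
  qed
  define rep where "rep S x = (THE y. f y = f x \<and> y \<in> S)" for S x
  have rep: "f (rep S x) = f x" "rep S x \<in> S" if "is_transversal (kernel f) S" for S x
    using theI'[OF ex[OF that, of x]] by (auto simp: rep_def)
  have uniq: "y = z" if "is_transversal (kernel f) S" "f y = f z" "y \<in> S" "z \<in> S" for S y z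
    using ex[OF that(1), of z] that by auto
  define g where "g S S' x = (if x \<in> S' then rep S x else x)" for S S' x
  have maps: "g S S' x \<in> UNIV - S'"
    if S: "is_transversal (kernel f) S" "is_transversal (kernel f) S'" and x: "x \<in> UNIV - S"
    for S S' x
    using rep[OF S(1), of x] uniq[OF S(2), of "rep S x" x] x by (auto simp: g_def)
  have inv: "g S' S (g S S' x) = x"
    if S: "is_transversal (kernel f) S" "is_transversal (kernel f) S'" and x: "x \<in> UNIV - S"
    for S S' x
    using rep[OF S(1), of x] rep[OF S(2), of "rep S x"]
      uniq[OF S(2), of "rep S' (rep S x)" x] x by (auto simp: g_def)
  have "bij_betw (g T T') (UNIV - T) (UNIV - T')"
    by (rule bij_betw_byWitness[where f' = "g T' T"])
      (use maps[OF assms] maps[OF assms(2,1)] inv[OF assms] inv[OF assms(2,1)] in blast)+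
  then show ?thesis by (rule card_of_ordIsoI)
qed

lemma collapse_ordIso:
  assumes "is_transversal (kernel f) T"
  shows "collapse f =o |UNIV - T|"
  unfolding collapse_def
  by (rule transversals_same_card[OF someI_ex[OF ex_transversal_kernel] assms])

definition subsemigroup :: "('b \<Rightarrow> 'b) set \<Rightarrow> bool" where
  "subsemigroup S \<longleftrightarrow> (\<forall>f \<in> S. \<forall>g \<in> S. g \<circ> f \<in> S)"

definition semi_balanced_semigroup :: "('b \<Rightarrow> 'b) set \<Rightarrow> bool" where
  "semi_balanced_semigroup S \<longleftrightarrow> subsemigroup S \<and> (\<forall>f \<in> S. semi_balanced f)"

definition linear_maps :: "('a::field \<Rightarrow> 'b::ab_group_add \<Rightarrow> 'b) \<Rightarrow> ('b \<Rightarrow> 'b) set" where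
  "linear_maps scale = {f. Vector_Spaces.linear scale scale f}"

lemma subsemigroup_linear_maps: "subsemigroup (linear_maps scale)"
  by (auto simp: subsemigroup_def linear_maps_def intro: Vector_Spaces.linear_compose)

end

theory Submission
  imports Defs
begin

text \<open>If \<open>V\<close> is finite-dimensional, a linear section of \<open>f\<close> over its range has as image a subspace
  \<open>W\<close> that is a transversal of the kernel of \<open>f\<close>. The restriction of \<open>f\<close> to \<open>W\<close> extends to an
  automorphism of \<open>V\<close>, which maps \<open>V - W\<close> bijectively onto the complement of the range of \<open>f\<close>;
  no cardinal arithmetic is needed. If \<open>V\<close> has an infinite basis, an injection of the basis onto
  itself minus one element induces an injective linear map that is not surjective.\<close>

text \<open>The kernel classes are the fibres of \<open>f\<close>, and a point \<open>h y\<close>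
  with \<open>y\<close> in the range lies only in the fibre over \<open>y\<close>. The section is
  arbitrary here, so this applies both to \<open>inv f\<close> and to a linear section.\<close>

lemma is_transversal_section:
  assumes sect: "\<And>y. y \<in> range f \<Longrightarrow> f (h y) = y"
  shows "is_transversal (kernel f) (h ` range f)"
proof -
  have "\<exists>!x. x \<in> X \<inter> h ` range f" if "X \<in> UNIV // kernel f" for X
  proof -
    have "kernel f `` {a} = {y. f y = f a}" for a
      by (auto simp: kernel_def)
    with that obtain a where X: "X = {y. f y = f a}"
      by (auto simp: quotient_def)
    show ?thesis
      proof (rule ex1I[of _ "h (f a)"])
      show "h (f a) \<in> X \<inter> h ` range f"
        by (simp add: X sect)
      show "x = h (f a)" if "x \<in> X \<inter> h ` range f" for x
        using that sect by (metis (mono_tags, lifting) IntE X image_iff mem_Collect_eq)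
    qed
  qed
  then show ?thesis by (simp add: is_transversal_def)
qed

text \<open>The kernel classes of an injective map are singletons, so the whole space is a
  transversal.\<close>

lemma collapse_inj:
  assumes "inj (f :: 'b \<Rightarrow> 'b)"
  shows "collapse f =o |{} :: 'b set|"
proof -
  have "is_transversal (kernel f) (inv f ` range f)"
    by (rule is_transversal_section) (rule f_inv_into_f)
  moreover have "inv f ` range f = UNIV"
    using assms by (simp add: image_image)
  ultimately show ?thesis
    using collapse_ordIso[of f UNIV] by simp
qed

lemma inj_semi_balanced_imp_surj:
  assumes "inj (f :: 'b \<Rightarrow> 'b)" "semi_balanced f"
  shows "surj f"
proof -
  have "|UNIV - range f| =o |{} :: 'b set|"
    using assms ordIso_transitive[OF ordIso_symmetric collapse_inj]
    unfolding semi_balanced_def defect_def by blast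
  then show ?thesis
    using card_of_empty2 by blast
qed

lemma (in finite_dimensional_vector_space) linear_semi_balanced:
  assumes f: "Vector_Spaces.linear scale scale f"
  shows "semi_balanced f"
proof -
  interpret vector_space_pair scale scale by unfold_locales
  obtain h where h: "Vector_Spaces.linear scale scale h" and sect: "\<And>y. y \<in> range f \<Longrightarrow> f (h y) = y"
    using linear_exists_right_inverse_on[OF f subspace_UNIV] by auto
  \<comment> \<open>\<open>C\<close> is a basis of the range. The section carries it to a basis
    \<open>h\<close> C\<open>of the subspace\<close>h \<open>range f\<close>, and \<open>f\<close>
    maps that basis bijectively back onto \<open>C\<close>.\<close>
  obtain C where C: "C \<subseteq> range f" "independent C" "range f \<subseteq> span C"
    by (rule maximal_independent_subset)
  have span_C: "span C = range f"
    using span_minimal[OF C(1) linear_subspace_image[OF f subspace_UNIV]] C(3) by (rule subset_antisym)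
  have "inj_on h (range f)"
    using sect by (rule inj_on_inverseI)
  then have indep: "independent (h ` C)"
    using linear_independent_injective_image[OF h C(2)] by (simp add: span_C)
  have sect_C: "f (h y) = y" if "y \<in> C" for y
    using C(1) that by (intro sect) blast
  then have f_h_C: "f ` h ` C = C"
    by (simp add: image_image)
  have "inj_on f (h ` C)"
    using sect_C by (intro inj_on_inverseI[of _ h]) auto
  then obtain \<phi> where \<phi>: "Vector_Spaces.linear scale scale \<phi>" "inj \<phi>"
    and \<phi>_eq: "\<And>x. x \<in> h ` C \<Longrightarrow> \<phi> x = f x"
    using linear_independent_extend_inj[OF indep, of f] C(2) unfolding f_h_C by blast
  define W where "W = h ` range f"
  have "\<phi> x = f x" if "x \<in> W" for x
  proof (rule linear_eq_on[OF \<phi>(1) f])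
    show "x \<in> span (h ` C)"
      using that linear_span_image[OF h, of C] by (simp add: W_def span_C)
  qed (rule \<phi>_eq)
  then have "\<phi> ` W = f ` W" by simp
  also have "\<dots> = range f"
    by (simp add: W_def image_image sect)
  finally have "bij_betw \<phi> (UNIV - W) (UNIV - range f)"
    using \<phi> linear_inj_imp_surj[OF \<phi>]
    by (auto simp: bij_betw_def image_set_diff intro: inj_on_subset)
  then have "|UNIV - W| =o defect f"
    unfolding defect_def by (rule card_of_ordIsoI)
  moreover have "collapse f =o |UNIV - W|"
    unfolding W_def by (rule collapse_ordIso[OF is_transversal_section]) (rule sect)
  ultimately show ?thesis
    unfolding semi_balanced_def using ordIso_transitive by blast
qed

lemma (in vector_space) infinite_basis_imp_inj_not_surj:
  assumes B: "independent B" "span B = UNIV" and "infinite B"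
  obtains f where "Vector_Spaces.linear scale scale f" "inj f" "\<not> surj f"
proof -
  interpret vector_space_pair scale scale by unfold_locales
  from \<open>infinite B\<close> obtain b where b: "b \<in> B" by fastforce
  obtain s where s: "bij_betw s B (B - {b})"
    using infinite_imp_bij_betw[OF \<open>infinite B\<close>] by blast
  define f where "f = construct B s"
  have f: "Vector_Spaces.linear scale scale f"
    unfolding f_def by (rule linear_construct[OF B(1)])
  have "bij_betw f B (B - {b})"
    using s bij_betw_cong[of B f s] construct_basis[OF B(1)] by (simp add: f_def)
  then have image: "f ` B = B - {b}" and inj: "inj_on f B"
    by (simp_all add: bij_betw_def)
  \<comment> \<open>A linear map that is injective on \<open>B\<close> with independent image is
    injective on the span of \<open>B\<close>, which is the whole space.\<close>
  have indep: "independent (f ` B)"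
    unfolding image using B(1) by (rule independent_mono) blast
  have "inj f"
    using linear_inj_on_span_independent_image[OF f indep inj] by (simp add: B(2))
  moreover have "b \<notin> range f"
  proof -
    \<comment> \<open>If \<open>b\<close> were in this span, \<open>B\<close> would be
      dependent.\<close>
    have "range f = span (B - {b})"
      using linear_span_image[OF f, of B] by (simp add: image B(2))
    then show ?thesis
      using B(1) b by (auto simp: dependent_def)
  qed
  ultimately show thesis
    using that f by blast
qed

theorem theorem5p9:
  fixes scale :: "'a::field \<Rightarrow> 'b::ab_group_add \<Rightarrow> 'b"
  assumes "vector_space scale"
  shows "semi_balanced_semigroup (linear_maps scale) \<longleftrightarrow>
    (\<exists>B. finite_dimensional_vector_space scale B)"
proof
  interpret vector_space scale by fact
  assume balanced: "semi_balanced_semigroup (linear_maps scale)"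
  \<comment> \<open>Every vector space has a basis; once it is shown finite, it is the witness that
    the locale requires.\<close>
  obtain B where B: "independent B" "span B = UNIV"
    using maximal_independent_subset[of UNIV] by (metis UNIV_I subsetI subset_antisym)
  have "finite B"
  proof (rule ccontr)
    assume "infinite B"
    with B obtain f where f: "Vector_Spaces.linear scale scale f" "inj f" "\<not> surj f"
      by (rule infinite_basis_imp_inj_not_surj)
    then have "semi_balanced f"
      using balanced by (simp add: semi_balanced_semigroup_def linear_maps_def)
    with f show False
      using inj_semi_balanced_imp_surj by blast
  qed
  with B have "finite_dimensional_vector_space scale B"
    by unfold_locales
  then show "\<exists>B. finite_dimensional_vector_space scale B" ..
next
  assume "\<exists>B. finite_dimensional_vector_space scale B"
  then obtain B where "finite_dimensional_vector_space scale B" ..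
  then interpret finite_dimensional_vector_space scale B .
  show "semi_balanced_semigroup (linear_maps scale)"
    unfolding semi_balanced_semigroup_def
    using subsemigroup_linear_maps linear_semi_balanced by (auto simp: linear_maps_def)
qed

end
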